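(* Let $W$ be a finite (real) reflection group with reflection representation $V$, let $g\in W$ be an arbitrary element, and let $c\in W$ be a Coxeter element, i.e. the product of all the simple reflections, each occurring exactly once, in some order; let $h$ be the order of $c$. Then the statistic $g\mapsto Tr_V(g)$ is $0$-mesic for $W$ with right multiplication by $c$. That is, $$\sum_{k=1}^{h} Tr_V(g\cdot c^k)=0 .$$
   Context: A finite reflection group $W$ is a finite Coxeter group with a fixed set of simple reflections; its reflection representation $V$ is the (essential) real representation in which the simple roots form a basis of $V$ and the simple reflections act as the orthogonal reflections in the hyperplanes orthogonal to the simple roots (for $W=S_n$ this is the $(n-1)$-dimensional irreducible representation indexed by $(n-1,1)$). $Tr_V(g)$ denotes the trace of the action of $g$ on $V$. A statistic is $c_0$-mesic for a bijection of a finite set if its average over each orbit of the bijection equals the constant $c_0$. *)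

theory Defs
  imports
    "HOL-Analysis.Analysis"
    "HOL-Algebra.Multiplicative_Group"
    "HOL-Algebra.Generated_Groups"
    "HOL-Combinatorics.Orbits"
begin

section \<open>Trace of an endomorphism of a finite-dimensional space\<close>

text \<open>
  The trace of the matrix of \<open>f\<close> with respect to some basis. The library's trace is only
  available for square matrices indexed by a (nonempty) type; the present version also covers the
  zero space, which is the reflection representation of the trivial group.
\<close>

definition trace_lin :: "('v::real_vector \<Rightarrow> 'v) \<Rightarrow> real" where
  "trace_lin f =
     (let B = (SOME B. independent B \<and> span B = UNIV) in \<Sum>b\<in>B. representation B (f b) b)"

lemma representation_expand:
  fixes B :: "'v::real_vector set"
  assumes "finite B" "independent B" "span B = UNIV"
  shows "(\<Sum>b\<in>B. representation B v b *\<^sub>R b) = v"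
  using real_vector.sum_representation_eq[of B v B] assms by auto

lemma representation_apply:
  fixes B C :: "'v::real_vector set"
  assumes f: "linear f" and B: "finite B" "independent B" "span B = UNIV"
    and C: "independent C" "span C = UNIV"
  shows "representation C (f v) c = (\<Sum>b\<in>B. representation B v b * representation C (f b) c)"
proof -
  have "f v = (\<Sum>b\<in>B. representation B v b *\<^sub>R f b)"
    by (subst representation_expand[OF B, of v, symmetric])
       (simp add: linear_sum[OF f] linear_scale[OF f])
  then show ?thesis
    using C by (simp add: real_vector.representation_sum real_vector.representation_scale)
qed

lemma trace_basis_independent:
  fixes B C :: "'v::real_vector set"
  assumes f: "linear f" and B: "finite B" "independent B" "span B = UNIV"
    and C: "finite C" "independent C" "span C = UNIV"
  shows "(\<Sum>b\<in>B. representation B (f b) b) = (\<Sum>c\<in>C. representation C (f c) c)"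
proof -
  have "(\<Sum>b\<in>B. representation B (f b) b)
      = (\<Sum>b\<in>B. \<Sum>c\<in>C. representation C (f b) c * representation B c b)"
    using representation_apply[OF linear_id C B(2,3)] unfolding id_apply
    by (intro sum.cong refl)
  also have "\<dots> = (\<Sum>c\<in>C. \<Sum>b\<in>B. representation B c b * representation C (f b) c)"
    by (subst sum.swap) (simp add: mult.commute)
  also have "\<dots> = (\<Sum>c\<in>C. representation C (f c) c)"
    by (rule sum.cong[OF refl]) (rule representation_apply[OF f B C(2,3), symmetric])
  finally show ?thesis .
qed

lemma trace_lin_eq:
  fixes B :: "'v::real_vector set"
  assumes "linear f" and B: "finite B" "independent B" "span B = UNIV"
  shows "trace_lin f = (\<Sum>b\<in>B. representation B (f b) b)"
proof -
  define C :: "'v set" where "C = (SOME B. independent B \<and> span B = UNIV)"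
  have C: "independent C" "span C = UNIV"
    using someI[of "\<lambda>B::'v set. independent B \<and> span B = UNIV" B] B by (auto simp: C_def)
  have "finite C"
    using real_vector.independent_span_bound[OF B(1) C(1)] B(3) by simp
  then show ?thesis
    using trace_basis_independent[OF assms(1) B \<open>finite C\<close> C]
    by (simp add: trace_lin_def C_def Let_def)
qed

lemma trace_lin_conv_trace_matrix:
  fixes f :: "real^'n \<Rightarrow> real^'n"
  assumes "linear f"
  shows "trace_lin f = trace (matrix f)"
proof -
  have rep: "representation Basis v b = v \<bullet> b" if "b \<in> Basis" for v b :: "real^'n"
  proof -
    have "v \<bullet> b = (\<Sum>u\<in>Basis. representation Basis v u *\<^sub>R u) \<bullet> b"
      by (subst representation_expand) (auto simp: independent_Basis)
    also have "\<dots> = representation Basis v b"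
      using that by (simp add: inner_sum_left_Basis)
    finally show ?thesis by simp
  qed
  have "trace_lin f = (\<Sum>b\<in>Basis. f b \<bullet> b)"
    using trace_lin_eq[OF assms, of Basis] by (simp add: independent_Basis rep)
  also have "(Basis :: (real^'n) set) = (\<lambda>i. axis i 1) ` UNIV"
    by (auto simp: Basis_vec_def)
  also have "(\<Sum>b\<in>\<dots>. f b \<bullet> b) = (\<Sum>i\<in>UNIV. f (axis i 1) \<bullet> axis i 1)"
    by (subst sum.reindex) (auto simp: inj_on_def axis_eq_axis)
  finally show ?thesis
    by (simp add: trace_def matrix_def inner_axis)
qed


section \<open>Coxeter systems\<close>

text \<open>
  The congruence on words over \<open>S\<close> generated by the relators \<open>(s t)\<^sup>m = 1\<close>, where \<open>m\<close> is the
  order of \<open>s t\<close> in \<open>G\<close>. The order function is \<open>0\<close> on elements of infinite order, so these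
  contribute only a trivial relator. If all generators are involutions then the case \<open>s = t\<close>
  provides the relators \<open>s s = 1\<close>, so formal inverses are not needed in words.
\<close>

inductive coxeter_congruent :: "('g, 'x) monoid_scheme \<Rightarrow> 'g set \<Rightarrow> 'g list \<Rightarrow> 'g list \<Rightarrow> bool"
  for G (structure) and S where
  relator: "\<lbrakk>s \<in> S; t \<in> S; us \<in> lists S; vs \<in> lists S\<rbrakk> \<Longrightarrow>
    coxeter_congruent G S (us @ concat (replicate (group.ord G (s \<otimes> t)) [s, t]) @ vs) (us @ vs)"
| refl: "us \<in> lists S \<Longrightarrow> coxeter_congruent G S us us"
| sym: "coxeter_congruent G S us vs \<Longrightarrow> coxeter_congruent G S vs us"
| trans: "\<lbrakk>coxeter_congruent G S us vs; coxeter_congruent G S vs ws\<rbrakk> \<Longrightarrow>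
    coxeter_congruent G S us ws"

definition word_product :: "('g, 'x) monoid_scheme \<Rightarrow> 'g list \<Rightarrow> 'g" where
  "word_product G ws = foldr (\<otimes>\<^bsub>G\<^esub>) ws \<one>\<^bsub>G\<^esub>"

text \<open>
  The last assumption says that \<open>G\<close> is presented by the relators above; the converse implication
  holds in every group.
\<close>

locale coxeter_system = group G for G :: "('g, 'x) monoid_scheme" (structure) +
  fixes S :: "'g set"
  assumes simple_subset: "S \<subseteq> carrier G"
    and simple_generate: "generate G S = carrier G"
    and simple_order: "s \<in> S \<Longrightarrow> ord s = 2"
    and presentation: "\<lbrakk>ws \<in> lists S; word_product G ws = \<one>\<rbrakk> \<Longrightarrow> coxeter_congruent G S ws []"

definition coxeter_element :: "('g, 'x) monoid_scheme \<Rightarrow> 'g set \<Rightarrow> 'g \<Rightarrow> bool" where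
  "coxeter_element G S c \<longleftrightarrow> (\<exists>ws. distinct ws \<and> set ws = S \<and> c = word_product G ws)"


section \<open>Finite reflection groups and their reflection representation\<close>

definition reflection :: "'v::real_inner \<Rightarrow> 'v \<Rightarrow> 'v" where
  "reflection a v = v - (2 * (v \<bullet> a) / (a \<bullet> a)) *\<^sub>R a"

text \<open>
  The space is the whole type \<open>'v\<close>, finite-dimensional by \<open>roots_span\<close>. The roots may have any
  lengths; \<open>roots_angle\<close> says that the angle between the simple roots of \<open>s\<close> and \<open>t\<close> is
  \<open>\<pi> - \<pi> / m\<close>, where \<open>m\<close> is the order of \<open>s t\<close>. Without it, Galois conjugates of the reflection
  representation (for instance, for the dihedral group of order 10) would be admitted.
\<close>

locale finite_reflection_group = coxeter_system G S
  for G :: "('g, 'x) monoid_scheme" (structure) and S +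
  fixes \<rho> :: "'g \<Rightarrow> 'v::real_inner \<Rightarrow> 'v"
    and \<alpha> :: "'g \<Rightarrow> 'v"
  assumes finite_group: "finite (carrier G)"
    and rep_linear: "g \<in> carrier G \<Longrightarrow> linear (\<rho> g)"
    and rep_one: "\<rho> \<one> = id"
    and rep_mult: "\<lbrakk>g \<in> carrier G; h \<in> carrier G\<rbrakk> \<Longrightarrow> \<rho> (g \<otimes> h) = \<rho> g \<circ> \<rho> h"
    and roots_inj: "inj_on \<alpha> S"
    and roots_independent: "independent (\<alpha> ` S)"
    and roots_span: "span (\<alpha> ` S) = UNIV"
    and roots_angle: "\<lbrakk>s \<in> S; t \<in> S\<rbrakk> \<Longrightarrow>
      \<alpha> s \<bullet> \<alpha> t = - cos (pi / real (ord (s \<otimes> t))) * norm (\<alpha> s) * norm (\<alpha> t)"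
    and rep_simple: "s \<in> S \<Longrightarrow> \<rho> s = reflection (\<alpha> s)"


section \<open>Homomesy\<close>

definition mesic :: "real \<Rightarrow> ('a \<Rightarrow> real) \<Rightarrow> 'a set \<Rightarrow> ('a \<Rightarrow> 'a) \<Rightarrow> bool" where
  "mesic c\<^sub>0 f X T \<longleftrightarrow> finite X \<and> bij_betw T X X \<and>
     (\<forall>x\<in>X. (\<Sum>y\<in>orbit T x. f y) / real (card (orbit T x)) = c\<^sub>0)"

end

theory Submission
  imports Defs
begin

text \<open>
  A Coxeter element \<open>c\<close> has no nonzero fixed vector in the reflection representation. It acts as a
  product of reflections in linearly independent roots, and such a product moves a vector only
  along the span of the roots involved; by independence no displacement along the first root can be
  cancelled by the remaining factors, so a fixed vector is fixed by every single reflection. It is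
  then orthogonal to all simple roots, and these span the space (\<open>coxeter_element_fixes_only_zero\<close>).

  The sum \<open>\<rho>(c) + \<rho>(c\<^sup>2) + \<dots> + \<rho>(c\<^sup>h)\<close> takes values in the fixed space of \<open>\<rho>(c)\<close>, since multiplication
  by \<open>c\<close> only permutes the summands. Hence it is the zero operator, and so is its composition with
  \<open>\<rho>(g)\<close>. Linearity of the trace gives the identity. As \<open>c\<close> has order \<open>h\<close>, an orbit of right
  multiplication by \<open>c\<close> consists of exactly the \<open>h\<close> distinct elements \<open>g c\<^sup>k\<close>, so the identity says
  that the trace sums to zero over each orbit.
\<close>

lemma foldr_reflection_diff_in_span: "foldr reflection as v - v \<in> span (set as)"
proof (induction as)
  case (Cons a as)
  let ?w = "foldr reflection as v"
  have "?w - v \<in> span (set (a # as))"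
    by (rule subsetD[OF span_mono Cons.IH]) auto
  then have "(?w - v) - (2 * (?w \<bullet> a) / (a \<bullet> a)) *\<^sub>R a \<in> span (set (a # as))"
    by (rule span_diff) (simp add: span_scale span_base)
  then show ?case
    by (simp add: reflection_def[of a] algebra_simps)
qed (simp add: span_zero)

text \<open>
  If \<open>w\<close> is the image of \<open>v\<close> under all factors but the outermost, then \<open>w - v\<close> is at once a multiple
  of the first root and a combination of the others; independence forces \<open>w = v\<close>.
\<close>

lemma fixed_by_independent_reflections_orthogonal:
  assumes "distinct as" "independent (set as)" "foldr reflection as v = v" "a \<in> set as"
  shows "v \<bullet> a = 0"
  using assms
proof (induction as)
  case (Cons b as)
  define w where "w = foldr reflection as v"
  define k where "k = 2 * (w \<bullet> b) / (b \<bullet> b)"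
  have ind: "independent (set as)" and b: "b \<notin> span (set as)"
    using Cons.prems(1,2) independent_insert[of b "set as"] by auto
  have diff: "w - v = k *\<^sub>R b"
    using Cons.prems(3) by (simp add: w_def k_def reflection_def[of b] algebra_simps)
  have "k *\<^sub>R b \<in> span (set as)"
    using foldr_reflection_diff_in_span[of as v] diff by (simp add: w_def)
  then have k: "k = 0"
    using b span_scale[of "k *\<^sub>R b" "set as" "inverse k"] by (cases "k = 0") auto
  have "b \<noteq> 0"
    using b span_zero by metis
  with k diff have "w = v" "v \<bullet> b = 0"
    by (auto simp: k_def)
  then show ?case
    using Cons.IH Cons.prems ind by (auto simp: w_def)
qed simp

context finite_reflection_group
begin

lemma word_product_closed: "ws \<in> lists S \<Longrightarrow> word_product G ws \<in> carrier G"
  using simple_subset by (induction ws) (auto simp: word_product_def)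

lemma rep_word_product: "ws \<in> lists S \<Longrightarrow> \<rho> (word_product G ws) v = foldr reflection (map \<alpha> ws) v"
proof (induction ws)
  case Nil
  then show ?case by (simp add: word_product_def rep_one)
next
  case (Cons s ws)
  then have "s \<in> S" "ws \<in> lists S" by auto
  then have "\<rho> (s \<otimes> word_product G ws) v = reflection (\<alpha> s) (\<rho> (word_product G ws) v)"
    using simple_subset word_product_closed by (simp add: rep_mult rep_simple subset_iff)
  with Cons.IH[OF \<open>ws \<in> lists S\<close>] show ?case
    by (simp add: word_product_def)
qed

lemma coxeter_element_closed: "coxeter_element G S c \<Longrightarrow> c \<in> carrier G"
  by (auto simp: coxeter_element_def intro: word_product_closed)

lemma coxeter_element_fixes_only_zero:
  assumes "coxeter_element G S c" "\<rho> c v = v"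
  shows "v = 0"
proof -
  obtain ws where ws: "distinct ws" "set ws = S" "c = word_product G ws"
    using assms(1) by (auto simp: coxeter_element_def)
  have "foldr reflection (map \<alpha> ws) v = v"
    using assms(2) ws rep_word_product[of ws v] by (auto simp: in_lists_conv_set)
  moreover have "distinct (map \<alpha> ws)"
    using ws roots_inj by (simp add: distinct_map)
  ultimately have "v \<bullet> a = 0" if "a \<in> \<alpha> ` S" for a
    using fixed_by_independent_reflections_orthogonal[of "map \<alpha> ws" v a]
      roots_independent ws that by simp
  then have "orthogonal v v"
    by (intro orthogonal_to_span[of v "\<alpha> ` S"]) (auto simp: roots_span orthogonal_def)
  then show ?thesis
    by (simp add: orthogonal_def)
qed

lemma sum_powers_coxeter_element_zero:
  assumes c: "coxeter_element G S c"
  shows "(\<Sum>k = 1..ord c. \<rho> (c [^] k) v) = 0"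
proof (rule coxeter_element_fixes_only_zero[OF c])
  have cG: "c \<in> carrier G" by (rule coxeter_element_closed[OF c])
  have h: "1 \<le> ord c" using ord_ge_1[OF finite_group cG] .
  let ?f = "\<lambda>k. \<rho> (c [^] (k::nat)) v"
  have step: "\<rho> c (?f k) = ?f (Suc k)" for k
    using rep_mult[OF cG, of "c [^] k"] cG by (subst nat_pow_Suc2) simp_all
  have "\<rho> c (\<Sum>k = 1..ord c. ?f k) = (\<Sum>k = 1..ord c. ?f (Suc k))"
    by (simp add: linear_sum[OF rep_linear[OF cG]] step del: nat_pow_Suc)
  also have "\<dots> = (\<Sum>k = Suc 1..Suc (ord c). ?f k)"
    by (rule sum.shift_bounds_cl_Suc_ivl[symmetric])
  also have "\<dots> = (\<Sum>k = Suc 1..ord c. ?f k) + ?f (Suc (ord c))"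
    using h by simp
  also have "?f (Suc (ord c)) = ?f 1"
    using cG by simp
  also have "(\<Sum>k = Suc 1..ord c. ?f k) + ?f 1 = (\<Sum>k = 1..ord c. ?f k)"
    using h by (subst (2) sum.atLeast_Suc_atMost) (simp_all add: add.commute)
  finally show "\<rho> c (\<Sum>k = 1..ord c. ?f k) = (\<Sum>k = 1..ord c. ?f k)" .
qed

lemma sum_trace_coxeter_powers_zero:
  assumes c: "coxeter_element G S c" and g: "g \<in> carrier G"
  shows "(\<Sum>k = 1..ord c. trace_lin (\<rho> (g \<otimes> c [^] k))) = 0"
proof -
  have cG: "c \<in> carrier G" by (rule coxeter_element_closed[OF c])
  have zero: "(\<Sum>k = 1..ord c. \<rho> (g \<otimes> c [^] k) v) = 0" for v
  proof -
    have "(\<Sum>k = 1..ord c. \<rho> (g \<otimes> c [^] k) v) = \<rho> g (\<Sum>k = 1..ord c. \<rho> (c [^] k) v)"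
      using g cG by (simp add: rep_mult linear_sum[OF rep_linear[OF g]])
    then show ?thesis
      using sum_powers_coxeter_element_zero[OF c] linear_0[OF rep_linear[OF g]] by simp
  qed
  let ?B = "\<alpha> ` S"
  have "finite ?B"
    using finite_subset[OF simple_subset finite_group] by simp
  then have "(\<Sum>k = 1..ord c. trace_lin (\<rho> (g \<otimes> c [^] k)))
      = (\<Sum>k = 1..ord c. \<Sum>b\<in>?B. representation ?B (\<rho> (g \<otimes> c [^] k) b) b)"
    using g cG by (intro sum.cong refl trace_lin_eq rep_linear roots_independent roots_span) auto
  also have "\<dots> = (\<Sum>b\<in>?B. representation ?B (\<Sum>k = 1..ord c. \<rho> (g \<otimes> c [^] k) b) b)"
    by (subst sum.swap)
       (simp add: real_vector.representation_sum[OF roots_independent] roots_span)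
  also have "\<dots> = 0"
    unfolding zero by (simp add: real_vector.representation_zero)
  finally show ?thesis .
qed

end

context group
begin

lemma bij_betw_right_mult:
  assumes "c \<in> carrier G"
  shows "bij_betw (\<lambda>g. g \<otimes> c) (carrier G) (carrier G)"
  using assms by (intro bij_betwI[where g = "\<lambda>g. g \<otimes> inv c"]) (auto simp: m_assoc)

lemma orbit_right_mult:
  assumes fin: "finite (carrier G)" and c: "c \<in> carrier G" and g: "g \<in> carrier G"
  shows "orbit (\<lambda>g. g \<otimes> c) g = (\<lambda>k. g \<otimes> c [^] k) ` {1..ord c}"
proof (rule subset_antisym)
  have h: "1 \<le> ord c" using ord_ge_1[OF fin c] .
  show "orbit (\<lambda>g. g \<otimes> c) g \<subseteq> (\<lambda>k. g \<otimes> c [^] k) ` {1..ord c}"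
  proof
    fix x assume "x \<in> orbit (\<lambda>g. g \<otimes> c) g"
    then show "x \<in> (\<lambda>k. g \<otimes> c [^] k) ` {1..ord c}"
    proof induction
      case base
      show ?case using h c by (intro image_eqI[where x = 1]) auto
    next
      case (step y)
      then obtain k where k: "1 \<le> k" "k \<le> ord c" "y = g \<otimes> c [^] k" by auto
      show ?case
      proof (cases "k = ord c")
        case True
        then have "y \<otimes> c = g \<otimes> c [^] (1::nat)" using k c g by simp
        then show ?thesis using h by (intro image_eqI[where x = 1]) auto
      next
        case False
        then have "y \<otimes> c = g \<otimes> c [^] Suc k" "Suc k \<in> {1..ord c}"
          using k c g by (auto simp: m_assoc)
        then show ?thesis by blast
      qed
    qed
  qed
  have orbit_pow: "g \<otimes> c [^] Suc k \<in> orbit (\<lambda>g. g \<otimes> c) g" for k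
  proof (induction k)
    case 0
    show ?case using orbit.base[of "\<lambda>g. g \<otimes> c" g] c by simp
  next
    case (Suc k)
    then show ?case
      using orbit.step[OF Suc] c g by (simp add: m_assoc)
  qed
  show "(\<lambda>k. g \<otimes> c [^] k) ` {1..ord c} \<subseteq> orbit (\<lambda>g. g \<otimes> c) g"
  proof
    fix x assume "x \<in> (\<lambda>k. g \<otimes> c [^] k) ` {1..ord c}"
    then obtain k where "k \<in> {1..ord c}" "x = g \<otimes> c [^] k" by blast
    then show "x \<in> orbit (\<lambda>g. g \<otimes> c) g"
      using orbit_pow[of "k - 1"] by (simp del: nat_pow_Suc)
  qed
qed

lemma inj_on_mult_pow:
  assumes c: "c \<in> carrier G" and g: "g \<in> carrier G"
  shows "inj_on (\<lambda>k. g \<otimes> c [^] k) {1..ord c}"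
proof (rule inj_onI)
  fix i j assume ij: "i \<in> {1..ord c}" "j \<in> {1..ord c}" "g \<otimes> c [^] i = g \<otimes> c [^] j"
  then have "c [^] i = c [^] j" using c g by simp
  then show "i = j" using inj_onD[OF ord_inj'[OF c]] ij(1,2) by blast
qed

end

theorem proposition3p2:
  fixes G :: "('g, 'x) monoid_scheme" (structure)
    and S :: "'g set"
    and \<rho> :: "'g \<Rightarrow> 'v::real_inner \<Rightarrow> 'v"
    and \<alpha> :: "'g \<Rightarrow> 'v"
    and c :: 'g
  assumes "finite_reflection_group G S \<rho> \<alpha>"
    and "coxeter_element G S c"
  shows "mesic 0 (\<lambda>g. trace_lin (\<rho> g)) (carrier G) (\<lambda>g. g \<otimes> c) \<and>
    (\<forall>g\<in>carrier G. (\<Sum>k = 1..group.ord G c. trace_lin (\<rho> (g \<otimes> c [^] k))) = 0)"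
proof -
  interpret finite_reflection_group G S \<rho> \<alpha> by fact
  have c: "c \<in> carrier G" by (rule coxeter_element_closed[OF assms(2)])
  note zero = sum_trace_coxeter_powers_zero[OF assms(2)]
  have "(\<Sum>y\<in>orbit (\<lambda>g. g \<otimes> c) g. trace_lin (\<rho> y)) = 0" if g: "g \<in> carrier G" for g
    using zero[OF g] unfolding orbit_right_mult[OF finite_group c g]
    by (subst sum.reindex[OF inj_on_mult_pow[OF c g]]) (simp add: comp_def)
  then show ?thesis
    using zero finite_group bij_betw_right_mult[OF c] by (simp add: mesic_def)
qed

end
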